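(* For the recursively defined rectangle family $P_3$, $$\frac{\alpha^*(P_3)}{\nu(P_3)}\ge\frac{73}{32},$$ where $\alpha^*$ is the optimum of the standard clique relaxation (equivalently, the point relaxation) for Maximum Independent Set of Rectangles.
   Context: All rectangles are closed and axis-parallel. For a finite rectangle family $\mathcal R$, $\nu(\mathcal R)$ is the maximum size of a pairwise disjoint subfamily, and $G(\mathcal R)$ is the intersection graph (vertices are the rectangles, edges join intersecting pairs). The clique relaxation value is $$\alpha^*(\mathcal R)=\alpha^*(G(\mathcal R))=\max\Big\{\sum_{v}x_v:\ x_v\ge 0,\ \sum_{v\in K}x_v\le 1\text{ for every clique }K\text{ of }G(\mathcal R)\Big\}.$$ Construction of $P_r$. Write $[q]=\{0,1,\dots,q-1\}$. Each $P_r$ is a finite rectangle family drawn in a square $[0,L]^2$ together with $q$ vertical marker lines $x=\xi_0,\dots,x=\xi_{q-1}$ and $q$ horizontal marker lines $y=\eta_0,\dots,y=\eta_{q-1}$ (in increasing order). Base: $P_0$ has $L=30$, $q=4$, $\xi=(3,11,19,27)$, $\eta=(3,11,21,27)$ and consists of the eight rectangles $T=[0,30]\times[26,28]$, $U_L=[0,16]\times[20,22]$, $U_R=[14,30]\times[20,22]$, $C_0=[0,8]\times[2,10]$, $C_1=[6,16]\times[8,14]$, $C_2=[14,24]\times[8,14]$, $C_3=[22,30]\times[2,12]$, $Q=[6,24]\times[0,4]$. Crossbar step: given $P$ with data $L,q,\xi,\eta$, put $M=L+1$, and for $R=[x_1,x_2]\times[y_1,y_2]\in P$ and $i,j\in[q]$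 let $$H_i(R)=[Mx_1,Mx_2]\times[M\xi_i+y_1,M\xi_i+y_2],\qquad V_j(R)=[M\xi_j+y_1,M\xi_j+y_2]\times[Mx_1,Mx_2].$$ $C(P)$ is the family of all $H_i(R)$ and $V_j(R)$ with $R\in P$, $i,j\in[q]$. It is drawn in $[0,ML+L]^2$, with $q^2$ vertical markers $\xi'_{(j,t)}=M\xi_j+\eta_t$ and $q^2$ horizontal markers $\eta'_{(i,t)}=M\xi_i+\eta_t$, indexed by $[q]\times[q]$ and ordered lexicographically. Recursion: $P_{r+1}=C(P_r)$ for $r\ge0$. *)

theory Defs
  imports Complex_Main "HOL-Library.Ramsey"
begin

section \<open>Rectangle families, independent sets, and the clique relaxation\<close>

text \<open>\<open>Rect x1 x2 y1 y2\<close> stands for $[x_1,x_2]\times[y_1,y_2]$.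
  Rectangles are kept as coordinate quadruples because the construction below acts on coordinates;
  for nonempty rectangles this is the same as working with the point sets.\<close>

datatype rect = Rect (x1: real) (x2: real) (y1: real) (y2: real)

definition region :: "rect \<Rightarrow> (real \<times> real) set" where
  "region R = {x1 R..x2 R} \<times> {y1 R..y2 R}"

definition nu :: "rect set \<Rightarrow> nat" where
  "nu F = Max {card S | S. S \<subseteq> F \<and> pairwise (\<lambda>R R'. disjnt (region R) (region R')) S}"

definition intersection_edges :: "rect set \<Rightarrow> rect set set" where
  "intersection_edges F =
     {{R, R'} | R R'. R \<in> F \<and> R' \<in> F \<and> R \<noteq> R' \<and> region R \<inter> region R' \<noteq> {}}"

definition clique_feasible :: "'a set \<Rightarrow> 'a set set \<Rightarrow> ('a \<Rightarrow> real) \<Rightarrow> bool" where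
  "clique_feasible V E x \<longleftrightarrow>
     (\<forall>v\<in>V. 0 \<le> x v) \<and> (\<forall>K\<subseteq>V. clique K E \<longrightarrow> (\<Sum>v\<in>K. x v) \<le> 1)"

text \<open>For finite \<open>V\<close> the set below is nonempty and bounded (lemma \<open>graph_alpha_star_values\<close>),
  and the supremum is a maximum since the feasible region is a polytope.\<close>

definition graph_alpha_star :: "'a set \<Rightarrow> 'a set set \<Rightarrow> real" where
  "graph_alpha_star V E = Sup {\<Sum>v\<in>V. x v | x. clique_feasible V E x}"

definition alpha_star :: "rect set \<Rightarrow> real" where
  "alpha_star F = graph_alpha_star F (intersection_edges F)"

lemma graph_alpha_star_values:
  fixes V :: "'a set"
  assumes "finite V"
  shows "{\<Sum>v\<in>V. x v | x. clique_feasible V E x} \<noteq> {}"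
    and "bdd_above {\<Sum>v\<in>V. x v | x. clique_feasible V E x}"
proof -
  have "clique_feasible V E (\<lambda>_. 0)"
    by (simp add: clique_feasible_def)
  then show "{\<Sum>v\<in>V. x v | x. clique_feasible V E x} \<noteq> {}"
    by blast
  show "bdd_above {\<Sum>v\<in>V. x v | x. clique_feasible V E x}"
  proof (rule bdd_aboveI)
    fix s assume "s \<in> {\<Sum>v\<in>V. x v | x. clique_feasible V E x}"
    then obtain x where s: "s = (\<Sum>v\<in>V. x v)" and x: "clique_feasible V E x"
      by blast
    have "x v \<le> 1" if "v \<in> V" for v
    proof -
      have "clique {v} E" by (simp add: clique_def)
      then have "(\<Sum>v\<in>{v}. x v) \<le> 1"
        using x that unfolding clique_feasible_def by blast
      then show ?thesis by simp
    qed
    then show "s \<le> of_nat (card V) * 1"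
      unfolding s by (rule sum_bounded_above)
  qed
qed

text \<open>The clique relaxation coincides with the point relaxation (Helly property of boxes).\<close>

lemma clique_feasible_iff_point_feasible:
  assumes fin: "finite F" and ne: "\<And>R. R \<in> F \<Longrightarrow> region R \<noteq> {}"
  shows "clique_feasible F (intersection_edges F) x \<longleftrightarrow>
    (\<forall>R\<in>F. 0 \<le> x R) \<and> (\<forall>p. (\<Sum>R | R \<in> F \<and> p \<in> region R. x R) \<le> 1)"
    (is "_ \<longleftrightarrow> ?nonneg \<and> ?point")
proof
  assume cf: "clique_feasible F (intersection_edges F) x"
  have "(\<Sum>R | R \<in> F \<and> p \<in> region R. x R) \<le> 1" for p
  proof -
    have "clique {R \<in> F. p \<in> region R} (intersection_edges F)"
      by (auto simp: clique_def intersection_edges_def)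
    moreover have "{R \<in> F. p \<in> region R} \<subseteq> F" by blast
    ultimately show ?thesis
      using cf by (simp add: clique_feasible_def)
  qed
  then show "?nonneg \<and> ?point"
    using cf by (auto simp: clique_feasible_def)
next
  assume pf: "?nonneg \<and> ?point"
  have "(\<Sum>R\<in>K. x R) \<le> 1" if K: "K \<subseteq> F" "clique K (intersection_edges F)" for K
  proof (cases "K = {}")
    case False
    have finK: "finite K" using K(1) fin by (rule finite_subset)
    have meet: "region R \<inter> region R' \<noteq> {}" if "R \<in> K" "R' \<in> K" for R R'
    proof (cases "R = R'")
      case True
      then show ?thesis using ne[of R] K(1) \<open>R \<in> K\<close> by blast
    next
      case False
      then have "{R, R'} \<in> intersection_edges F"
        using K(2) that by (auto simp: clique_def)
      then obtain S S' where "{R, R'} = {S, S'}" "region S \<inter> region S' \<noteq> {}"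
        unfolding intersection_edges_def by blast
      then show ?thesis
        unfolding doubleton_eq_iff by (metis Int_commute)
    qed
    have ord: "x1 R' \<le> x2 R \<and> y1 R' \<le> y2 R" if "R \<in> K" "R' \<in> K" for R R'
      using meet[OF that] by (auto simp: region_def)
    define p where "p = (Max (x1 ` K), Max (y1 ` K))"
    have "p \<in> region R" if "R \<in> K" for R
    proof -
      have "x1 R \<le> Max (x1 ` K)" "y1 R \<le> Max (y1 ` K)"
        using that finK by simp_all
      moreover have "Max (x1 ` K) \<le> x2 R" "Max (y1 ` K) \<le> y2 R"
        using that finK False ord by (simp_all)
      ultimately show ?thesis
        by (simp add: p_def region_def)
    qed
    then have "K \<subseteq> {R \<in> F. p \<in> region R}"
      using K(1) by blast
    then have "(\<Sum>R\<in>K. x R) \<le> (\<Sum>R | R \<in> F \<and> p \<in> region R. x R)"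
      using fin pf by (intro sum_mono2) auto
    also have "\<dots> \<le> 1" using pf by blast
    finally show ?thesis .
  qed simp
  then show "clique_feasible F (intersection_edges F) x"
    using pf by (auto simp: clique_feasible_def)
qed


section \<open>The crossbar construction\<close>

text \<open>The number of markers $q$ is the common length of the two marker lists.\<close>

record drawing =
  rects :: "rect set"
  side :: real
  xi :: "real list"
  eta :: "real list"

definition P_base :: drawing where
  "P_base = \<lparr>
     rects =
       {Rect 0 30 26 28,
        Rect 0 16 20 22, Rect 14 30 20 22,
        Rect 0 8 2 10, Rect 6 16 8 14, Rect 14 24 8 14, Rect 22 30 2 12,
        Rect 6 24 0 4},
     side = 30,
     xi = [3, 11, 19, 27],
     eta = [3, 11, 21, 27]\<rparr>"

definition H_copy :: "real \<Rightarrow> real \<Rightarrow> rect \<Rightarrow> rect" where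
  "H_copy M c R = Rect (M * x1 R) (M * x2 R) (M * c + y1 R) (M * c + y2 R)"

definition V_copy :: "real \<Rightarrow> real \<Rightarrow> rect \<Rightarrow> rect" where
  "V_copy M c R = Rect (M * c + y1 R) (M * c + y2 R) (M * x1 R) (M * x2 R)"

text \<open>Both \<open>H_copy\<close> and \<open>V_copy\<close> are placed along the vertical markers \<open>xi\<close> of the old drawing, and the
  new vertical and horizontal marker lists coincide: each is
  $M\xi_j+\eta_t$ for $(j,t)\in[q]\times[q]$ in lexicographic order.\<close>

definition crossbar :: "drawing \<Rightarrow> drawing" where
  "crossbar D = (let M = side D + 1; q = length (xi D) in \<lparr>
     rects = {H_copy M (xi D ! i) R | i R. i < q \<and> R \<in> rects D} \<union>
             {V_copy M (xi D ! j) R | j R. j < q \<and> R \<in> rects D},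
     side = M * side D + side D,
     xi = [M * a + b. a \<leftarrow> xi D, b \<leftarrow> eta D],
     eta = [M * a + b. a \<leftarrow> xi D, b \<leftarrow> eta D]\<rparr>)"

primrec P_fam :: "nat \<Rightarrow> drawing" where
  "P_fam 0 = P_base"
| "P_fam (Suc r) = crossbar (P_fam r)"

end

theory Submission
  imports Defs
begin

text \<open>The number $q$ of markers squares at every crossbar step, so $P_3$ has $4^8 = 65536$ markers of each
direction. The ratio compares both quantities with this number.

Upper bound for \<open>nu\<close>. Call a drawing \<open>marker_bounded\<close> if every independent set hits at least
as many vertical markers, and at least as many horizontal markers, as it has members; then
\<open>nu\<close> is at most $q$ (\<open>marker_bounded_nu_le\<close>). The base drawing has this property, and a
crossbar step preserves it (\<open>marker_bounded_crossbar\<close>). In a crossbar, an independent set splits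
into independent sets of the old drawing, one for each row and each column. If some row piece hits the old
vertical marker $j$, then all $q$ new markers $(j,t)$ are hit; and since a row $i$ that hits $j$
rules out that column $j$ hits $i$, these rows together with the markers hit by column $j$ number at most $q$. If no
row piece hits $j$, the markers $(j,t)$ hit by column $j$ are counted by the horizontal markers that its
piece hits in the old drawing. Summing over $j$ gives the claim.

Lower bound for \<open>alpha_star\<close>. By the Helly property it suffices to give nonnegative weights whose
total at every point is at most 1. In a crossbar, weights are chosen separately for every row and every
column, and the load at a point is the load of at most one row plus the load of at most one column. The only
interaction is therefore at crossings, where the row's load on a vertical marker meets the column's load on a
vertical marker. To iterate the step, the bounds that have to be carried along are those on the load on each
vertical marker, on each horizontal marker, and at each crossing of two markers
(\<open>admissible\<close>, \<open>admissible_crossbar\<close>).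

A weight of $1/2^{r}$ on all of $P_r$, for $r \ge 1$, only gives the ratio 2. The improvement comes from the
difference between markers. In the base drawing the horizontal markers 3 and 11 meet only the five rectangles
that form a 5-cycle, and the markers 21 and 27 only the other three. This distinction survives as the residue
modulo 4 of a marker's index (\<open>low\<close>). Letting the capacity that a row of $P_3$ may use on a marker
depend on whether the row and the marker are low yields weights of total $151552 = (37/16) \cdot 65536$, and
$37/16 = 74/32 \ge 73/32$.\<close>

section \<open>Well-formed drawings\<close>

text \<open>All coordinates are integers, so scaling by \<open>side D + 1\<close> turns a unit of the old drawing into a
band that holds a whole copy of it. Every geometric argument below rests on this separation.\<close>

definition well_formed :: "drawing \<Rightarrow> bool" where
  "well_formed D \<longleftrightarrow>
     finite (rects D) \<and> side D \<in> \<int> \<and> 0 \<le> side D \<and>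
     length (eta D) = length (xi D) \<and> distinct (xi D) \<and> distinct (eta D) \<and>
     (\<forall>m\<in>set (xi D) \<union> set (eta D). m \<in> \<int> \<and> 0 \<le> m \<and> m \<le> side D) \<and>
     (\<forall>R\<in>rects D. x1 R \<in> \<int> \<and> x2 R \<in> \<int> \<and> y1 R \<in> \<int> \<and> y2 R \<in> \<int> \<and>
        0 \<le> x1 R \<and> x1 R < x2 R \<and> x2 R \<le> side D \<and>
        0 \<le> y1 R \<and> y1 R < y2 R \<and> y2 R \<le> side D)"

lemma Ints_less_iff_add1_le:
  fixes a b :: real
  assumes "a \<in> \<int>" "b \<in> \<int>"
  shows "a < b \<longleftrightarrow> a + 1 \<le> b"
  using assms by (auto elim!: Ints_cases)

text \<open>Uniqueness of division with remainder: it separates the bands of different copies and makes the new markers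
distinct.\<close>

lemma unique_integer_part:
  fixes a b s t M :: real
  assumes "a \<in> \<int>" "b \<in> \<int>" "0 \<le> s" "s < M" "0 \<le> t" "t < M" "M * a + s = M * b + t"
  shows "a = b \<and> s = t"
proof -
  have "\<not> a < b" if "a \<in> \<int>" "b \<in> \<int>" "s < M" "0 \<le> t" "0 \<le> s" "M * a + s = M * b + t"
    for a b s t :: real
  proof
    assume "a < b"
    then have "M * (a + 1) \<le> M * b"
      using that by (intro mult_left_mono) (auto simp: Ints_less_iff_add1_le)
    with that show False by (simp add: algebra_simps)
  qed
  from this[of a b s t] this[of b a t s] assms show ?thesis by fastforce
qed

lemma crossbar_sel:
  "rects (crossbar D) = (\<Union>i<length (xi D). H_copy (side D + 1) (xi D ! i) ` rects D) \<union>
                        (\<Union>j<length (xi D). V_copy (side D + 1) (xi D ! j) ` rects D)"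
  "side (crossbar D) = (side D + 1) * side D + side D"
  "xi (crossbar D) = map (\<lambda>(a, b). (side D + 1) * a + b) (List.product (xi D) (eta D))"
  "eta (crossbar D) = xi (crossbar D)"
proof -
  have eq: "concat (map (\<lambda>a. map (\<lambda>b. M * a + b) bs) as) =
    map (\<lambda>(a, b). M * a + b) (List.product as bs)" for M :: real and as bs
    by (induction as) (auto simp: comp_def)
  show "rects (crossbar D) = (\<Union>i<length (xi D). H_copy (side D + 1) (xi D ! i) ` rects D) \<union>
                        (\<Union>j<length (xi D). V_copy (side D + 1) (xi D ! j) ` rects D)"
    by (auto simp: crossbar_def Let_def)
  show "side (crossbar D) = (side D + 1) * side D + side D" "eta (crossbar D) = xi (crossbar D)"
    by (simp_all add: crossbar_def Let_def)
  show "xi (crossbar D) = map (\<lambda>(a, b). (side D + 1) * a + b) (List.product (xi D) (eta D))"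
    by (simp add: crossbar_def Let_def eq)
qed

lemma length_xi_crossbar:
  assumes "well_formed D"
  shows "length (xi (crossbar D)) = (length (xi D))\<^sup>2"
  using assms by (simp add: crossbar_sel well_formed_def power2_eq_square)

lemma nth_xi_crossbar:
  assumes "well_formed D" "k < (length (xi D))\<^sup>2"
  shows "xi (crossbar D) ! k =
    (side D + 1) * xi D ! (k div length (xi D)) + eta D ! (k mod length (xi D))"
  using assms by (simp add: crossbar_sel well_formed_def product_nth power2_eq_square)

lemma well_formed_crossbar:
  assumes wf: "well_formed D"
  shows "well_formed (crossbar D)"
proof -
  define M where "M = side D + 1"
  have M: "M \<in> \<int>" "1 \<le> M" "side D < M" "side D = M - 1"
    using wf by (auto simp: M_def well_formed_def)
  have marker: "m \<in> \<int>" "0 \<le> m" "m \<le> side D" if "m \<in> set (xi D) \<union> set (eta D)" for m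
    using wf that by (auto simp: well_formed_def)
  have rect: "x1 R \<in> \<int> \<and> x2 R \<in> \<int> \<and> y1 R \<in> \<int> \<and> y2 R \<in> \<int>"
      "0 \<le> x1 R" "x1 R < x2 R" "x2 R \<le> side D" "0 \<le> y1 R" "y1 R < y2 R" "y2 R \<le> side D"
    if "R \<in> rects D" for R
    using wf that by (auto simp: well_formed_def)
  have place: "M * a + b \<in> \<int>" "0 \<le> M * a + b" "M * a + b \<le> M * side D + side D"
    if "a \<in> \<int>" "b \<in> \<int>" "0 \<le> a" "0 \<le> b" "a \<le> side D" "b \<le> side D" for a b
    using that M by (auto intro!: add_mono mult_left_mono)
  have scale: "M * a \<in> \<int>" "0 \<le> M * a" "M * a \<le> M * side D + side D"
    if "a \<in> \<int>" "0 \<le> a" "a \<le> side D" for a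
    using place[of a 0] that by auto
  have "distinct (xi (crossbar D))"
    unfolding crossbar_sel distinct_map M_def[symmetric]
  proof
    show "distinct (List.product (xi D) (eta D))"
      using wf by (simp add: well_formed_def distinct_product)
    show "inj_on (\<lambda>(a, b). M * a + b) (set (List.product (xi D) (eta D)))"
    proof (rule inj_onI, clarsimp)
      fix a b a' b' assume "a \<in> set (xi D)" "b \<in> set (eta D)" "a' \<in> set (xi D)" "b' \<in> set (eta D)"
        "M * a + b = M * a' + b'"
      then show "a = a' \<and> b = b'"
        using marker[of a] marker[of b] marker[of a'] marker[of b'] M
        by (intro unique_integer_part) auto
    qed
  qed
  moreover have "m \<in> \<int> \<and> 0 \<le> m \<and> m \<le> side (crossbar D)" if "m \<in> set (xi (crossbar D))" for m
  proof -
    from that obtain a b where "a \<in> set (xi D)" "b \<in> set (eta D)" "m = M * a + b"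
      by (auto simp: crossbar_sel M_def)
    then show ?thesis
      using place[of a b] marker[of a] marker[of b] by (simp add: crossbar_sel M_def)
  qed
  moreover have "side (crossbar D) \<in> \<int>" "0 \<le> side (crossbar D)"
    using wf by (auto simp: crossbar_sel well_formed_def)
  moreover have "finite (rects (crossbar D))"
    using wf by (auto simp: crossbar_sel well_formed_def)
  moreover have "\<forall>R\<in>rects (crossbar D). x1 R \<in> \<int> \<and> x2 R \<in> \<int> \<and> y1 R \<in> \<int> \<and> y2 R \<in> \<int> \<and>
        0 \<le> x1 R \<and> x1 R < x2 R \<and> x2 R \<le> side (crossbar D) \<and>
        0 \<le> y1 R \<and> y1 R < y2 R \<and> y2 R \<le> side (crossbar D)"
  proof
    fix Q assume "Q \<in> rects (crossbar D)"
    then obtain k R where k: "k < length (xi D)" and R: "R \<in> rects D"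
      and Q: "Q = H_copy M (xi D ! k) R \<or> Q = V_copy M (xi D ! k) R"
      by (auto simp: crossbar_sel M_def)
    have "\<forall>c\<in>{x1 R, x2 R, y1 R, y2 R}. c \<in> \<int> \<and> 0 \<le> c \<and> c \<le> side D"
      using rect[OF R] by auto
    moreover have "xi D ! k \<in> \<int> \<and> 0 \<le> xi D ! k \<and> xi D ! k \<le> side D"
      using marker k by auto
    ultimately show "x1 Q \<in> \<int> \<and> x2 Q \<in> \<int> \<and> y1 Q \<in> \<int> \<and> y2 Q \<in> \<int> \<and>
        0 \<le> x1 Q \<and> x1 Q < x2 Q \<and> x2 Q \<le> side (crossbar D) \<and>
        0 \<le> y1 Q \<and> y1 Q < y2 Q \<and> y2 Q \<le> side (crossbar D)"
      using Q rect[OF R] M place scale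
      by (auto simp: H_copy_def V_copy_def crossbar_sel M_def[symmetric])
  qed
  ultimately show ?thesis
    by (simp add: well_formed_def crossbar_sel(4))
qed

lemma region_copies:
  assumes "M > 0"
  shows "(X, Y) \<in> region (H_copy M c R) \<longleftrightarrow> (X / M, Y - M * c) \<in> region R"
    and "(X, Y) \<in> region (V_copy M c R) \<longleftrightarrow> (Y / M, X - M * c) \<in> region R"
  using assms by (auto simp: region_def H_copy_def V_copy_def field_simps)

section \<open>Independent sets\<close>

definition independent :: "rect set \<Rightarrow> bool" where
  "independent S \<longleftrightarrow> pairwise (\<lambda>R R'. disjnt (region R) (region R')) S"

text \<open>The condition is half-open because of what scaling does to it. An integer marker $m < x_2$ satisfies
$m + 1 \le x_2$, so the whole band of width \<open>side D + 1\<close> that starts at the scaled marker lies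
within the scaled rectangle. With $m = x_2$ allowed, a row and a column could hit each other's markers without
meeting.\<close>

definition hit :: "real list \<Rightarrow> (rect \<Rightarrow> real) \<Rightarrow> (rect \<Rightarrow> real) \<Rightarrow> rect set \<Rightarrow> nat set" where
  "hit ms lo hi S = {k. k < length ms \<and> (\<exists>R\<in>S. lo R \<le> ms ! k \<and> ms ! k < hi R)}"

definition marker_bounded :: "drawing \<Rightarrow> bool" where
  "marker_bounded D \<longleftrightarrow> (\<forall>S\<subseteq>rects D. independent S \<longrightarrow>
     card S \<le> card (hit (xi D) x1 x2 S) \<and> card S \<le> card (hit (eta D) y1 y2 S))"

lemma hit_subset: "hit ms lo hi S \<subseteq> {..<length ms}"
  by (auto simp: hit_def)

lemma finite_hit [simp]: "finite (hit ms lo hi S)"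
  by (simp add: hit_def)

text \<open>Reflection in the diagonal swaps the rows and columns of a crossbar and maps it to itself. It carries
statements about rows and vertical markers over to columns and horizontal markers.\<close>

definition transposed :: "rect \<Rightarrow> rect" where
  "transposed R = Rect (y1 R) (y2 R) (x1 R) (x2 R)"

lemma transposed_sel [simp]:
  "x1 (transposed R) = y1 R" "x2 (transposed R) = y2 R"
  "y1 (transposed R) = x1 R" "y2 (transposed R) = x2 R"
  "transposed (transposed R) = R"
  by (simp_all add: transposed_def)

lemma V_copy_transposed: "V_copy M c R = transposed (H_copy M c R)"
  by (simp add: V_copy_def H_copy_def transposed_def)

lemma transposed_inject: "transposed R = transposed R' \<longleftrightarrow> R = R'"
  by (metis transposed_sel(5))

lemma independent_transposed:
  assumes "independent S"
  shows "independent (transposed ` S)"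
proof -
  have "(a, b) \<in> region (transposed R) \<longleftrightarrow> (b, a) \<in> region R" for a b R
    by (auto simp: region_def)
  then show ?thesis
    using assms unfolding independent_def pairwise_def disjnt_iff
    by (auto simp: transposed_inject)
qed

lemma rects_crossbar_transposed: "transposed ` rects (crossbar D) = rects (crossbar D)"
  by (simp add: crossbar_sel image_Un image_UN image_image V_copy_transposed Un_commute)

lemma H_copy_inject: "M \<noteq> 0 \<Longrightarrow> H_copy M c R = H_copy M c R' \<longleftrightarrow> R = R'"
  by (cases R; cases R') (auto simp: H_copy_def)

lemma independent_H_row:
  assumes "independent S" "M > 0"
  shows "independent {R \<in> F. H_copy M c R \<in> S}"
  unfolding independent_def pairwise_def
proof (intro ballI impI)
  fix R R' assume *: "R \<in> {R \<in> F. H_copy M c R \<in> S}" "R' \<in> {R \<in> F. H_copy M c R \<in> S}" "R \<noteq> R'"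
  then have "disjnt (region (H_copy M c R)) (region (H_copy M c R'))"
    using assms by (auto simp: independent_def pairwise_def H_copy_inject)
  show "disjnt (region R) (region R')"
    unfolding disjnt_iff
  proof (intro allI notI)
    fix p assume p: "p \<in> region R \<and> p \<in> region R'"
    have "(M * fst p, M * c + snd p) \<in> region (H_copy M c Q)" if "p \<in> region Q" for Q
      using that \<open>M > 0\<close> by (simp add: region_copies)
    with p \<open>disjnt (region (H_copy M c R)) _\<close> show False
      unfolding disjnt_iff by blast
  qed
qed

lemma independent_V_column:
  assumes "independent S" "M > 0"
  shows "independent {R \<in> F. V_copy M c R \<in> S}"
proof -
  have "{R \<in> F. V_copy M c R \<in> S} = {R \<in> F. H_copy M c R \<in> transposed ` S}"
    by (auto simp: V_copy_transposed image_iff intro: bexI[of _ "transposed _"])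
  then show ?thesis
    using independent_H_row[of "transposed ` S"] assms by (simp add: independent_transposed)
qed

text \<open>The conflict that drives the bound on \<open>nu\<close>: row $i$ and column $j$ cannot both be used towards
each other's markers. The two copies are different because a row copy is wider than a column copy can be;
without this, independence of a set containing both would say nothing.\<close>

lemma crossing_copies:
  assumes wf: "well_formed D" and R: "R \<in> rects D" and R': "R' \<in> rects D"
    and a: "a \<in> \<int>" "x1 R \<le> a" "a < x2 R" and b: "b \<in> \<int>" "x1 R' \<le> b" "b < x2 R'"
  shows "H_copy (side D + 1) b R \<noteq> V_copy (side D + 1) a R'"
    and "\<not> disjnt (region (H_copy (side D + 1) b R)) (region (V_copy (side D + 1) a R'))"
proof -
  define M where "M = side D + 1"
  have M: "M > 0" and L: "side D < M" using wf by (auto simp: M_def well_formed_def)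
  have in_band: "a + s / M \<le> c" if "a < c" "a \<in> \<int>" "c \<in> \<int>" "s \<le> side D" for a c s
  proof -
    have "s / M \<le> 1" using that M L by simp
    with that show ?thesis by (simp add: Ints_less_iff_add1_le)
  qed
  have R1: "x1 R \<in> \<int>" "x2 R \<in> \<int>" "y1 R \<le> y2 R" "0 \<le> y1 R" "y2 R \<le> side D"
    and R1': "x1 R' \<in> \<int>" "x2 R' \<in> \<int>" "y1 R' \<le> y2 R'" "0 \<le> y1 R'" "y2 R' \<le> side D"
    using wf R R' by (auto simp: well_formed_def)
  have "(M * a + y1 R', M * b + y1 R) \<in> region (H_copy M b R)"
       "(M * a + y1 R', M * b + y1 R) \<in> region (V_copy M a R')"
    using M L R1 R1' a b in_band[of a "x2 R" "y1 R'"] in_band[of b "x2 R'" "y1 R"]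
    by (auto simp: region_copies) (auto simp: region_def add_divide_distrib intro: add_increasing2)
  then show "\<not> disjnt (region (H_copy (side D + 1) b R)) (region (V_copy (side D + 1) a R'))"
    unfolding M_def[symmetric] disjnt_iff by blast
  have "M * x1 R + M \<le> M * x2 R"
    using R1 a M mult_left_mono[of "x1 R + 1" "x2 R" M]
    by (simp add: Ints_less_iff_add1_le[symmetric] distrib_left)
  then have "x2 (H_copy M b R) - x1 (H_copy M b R) > x2 (V_copy M a R') - x1 (V_copy M a R')"
    using R1' L by (simp add: H_copy_def V_copy_def)
  then show "H_copy (side D + 1) b R \<noteq> V_copy (side D + 1) a R'"
    unfolding M_def by auto
qed

text \<open>The new markers are counted in groups, the group of $j$ being all $(j,t)$. Let $n_j$ be the number of rows
whose piece hits $j$ in the old drawing. If $n_j > 0$ the whole group of $q$ markers is hit, and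
$n_j$ plus the size of column $j$ is at most $q$, because the size of column $j$ is at most the number of
vertical markers that it hits, and none of these is the index of one of the $n_j$ rows. If $n_j = 0$, the size
of column $j$ is at most the number of horizontal markers that it hits, which are hit markers of the group.
The sum of all $n_j$ bounds the total size of the rows.\<close>

lemma crossbar_vertical_hits:
  assumes wf: "well_formed D" and mb: "marker_bounded D"
    and S: "S \<subseteq> rects (crossbar D)" "independent S"
  shows "card S \<le> card (hit (xi (crossbar D)) x1 x2 S)"
proof -
  define q M where "q = length (xi D)" and "M = side D + 1"
  have M: "M > 0" "side D < M" using wf by (auto simp: M_def well_formed_def)
  have xi: "xi D ! k \<in> \<int>" "0 \<le> xi D ! k" if "k < q" for k
    using wf that by (auto simp: well_formed_def q_def)
  have eta: "0 \<le> eta D ! k" "eta D ! k < M" if "k < q" for k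
  proof -
    have "eta D ! k \<in> set (eta D)" using wf that by (simp add: well_formed_def q_def)
    then show "0 \<le> eta D ! k" "eta D ! k < M" using wf M by (force simp: well_formed_def)+
  qed
  have fin: "finite (rects D)" using wf by (simp add: well_formed_def)
  define H where "H i = {R \<in> rects D. H_copy M (xi D ! i) R \<in> S}" for i
  define V where "V j = {R \<in> rects D. V_copy M (xi D ! j) R \<in> S}" for j
  define A where "A i = hit (xi D) x1 x2 (H i)" for i
  define B where "B j = hit (xi D) x1 x2 (V j)" for j
  define N where "N = hit (xi (crossbar D)) x1 x2 S"
  define col where "col j = {t. t < q \<and> j * q + t \<in> N}" for j

  have ind: "independent (H i)" "independent (V i)" for i
    unfolding H_def V_def by (intro independent_H_row independent_V_column S M)+
  have card_H: "card (H i) \<le> card (A i)" for i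
    using mb ind unfolding marker_bounded_def A_def by (simp add: H_def)
  have card_V: "card (V j) \<le> card (B j)" "card (V j) \<le> card (hit (eta D) y1 y2 (V j))" for j
    using mb ind unfolding marker_bounded_def B_def by (simp_all add: V_def)
  \<comment> \<open>row \<open>i\<close> and column \<open>j\<close> cannot hit each other\<close>
  have no_cross: "i \<notin> B j" if "i < q" "j < q" "j \<in> A i" for i j
  proof
    assume "i \<in> B j"
    then obtain R' where R': "R' \<in> V j" "x1 R' \<le> xi D ! i" "xi D ! i < x2 R'"
      by (auto simp: B_def hit_def)
    from \<open>j \<in> A i\<close> obtain R where R: "R \<in> H i" "x1 R \<le> xi D ! j" "xi D ! j < x2 R"
      by (auto simp: A_def hit_def)
    have "H_copy M (xi D ! i) R \<noteq> V_copy M (xi D ! j) R'"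
      "\<not> disjnt (region (H_copy M (xi D ! i) R)) (region (V_copy M (xi D ! j) R'))"
      unfolding M_def using R R' xi that by (intro crossing_copies wf; simp add: H_def V_def)+
    moreover have "H_copy M (xi D ! i) R \<in> S" "V_copy M (xi D ! j) R' \<in> S"
      using R R' by (simp_all add: H_def V_def)
    ultimately show False
      using S(2) by (auto simp: independent_def pairwise_def)
  qed

  have new_marker: "j * q + t < length (xi (crossbar D))"
    "xi (crossbar D) ! (j * q + t) = M * xi D ! j + eta D ! t" if "j < q" "t < q" for j t
  proof -
    have "j * q + t < (j + 1) * q" using that by simp
    also have "\<dots> \<le> q * q" using that by (intro mult_right_mono) auto
    finally show "j * q + t < length (xi (crossbar D))"
      using wf by (simp add: length_xi_crossbar q_def power2_eq_square)
    moreover have "(j * q + t) div q = j" "(j * q + t) mod q = t" using that by simp_all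
    ultimately show "xi (crossbar D) ! (j * q + t) = M * xi D ! j + eta D ! t"
      using wf by (simp add: length_xi_crossbar nth_xi_crossbar q_def M_def)
  qed
  have col_full: "col j = {..<q}" if "i < q" "j < q" "j \<in> A i" for i j
  proof -
    from \<open>j \<in> A i\<close> obtain R where R: "R \<in> H i" "x1 R \<le> xi D ! j" "xi D ! j < x2 R"
      by (auto simp: A_def hit_def)
    have "x2 R \<in> \<int>" using R wf by (auto simp: H_def well_formed_def)
    then have "M * x1 R \<le> M * xi D ! j" "M * xi D ! j + M \<le> M * x2 R"
      using R that xi M mult_left_mono[of "xi D ! j + 1" "x2 R" M]
      by (auto simp: Ints_less_iff_add1_le[symmetric] distrib_left)
    moreover have "H_copy M (xi D ! i) R \<in> S" using R by (simp add: H_def)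
    ultimately have "j * q + t \<in> N" if "t < q" for t
    proof -
      have "M * x1 R \<le> M * xi D ! j + eta D ! t" "M * xi D ! j + eta D ! t < M * x2 R"
        using \<open>M * x1 R \<le> _\<close> \<open>_ \<le> M * x2 R\<close> eta[OF that] by linarith+
      with \<open>H_copy M (xi D ! i) R \<in> S\<close> show ?thesis
        unfolding N_def hit_def using new_marker[OF \<open>j < q\<close> that]
        by (intro CollectI conjI bexI[of _ "H_copy M (xi D ! i) R"]) (simp_all add: H_copy_def)
    qed
    then show ?thesis by (auto simp: col_def)
  qed
  have col_V: "hit (eta D) y1 y2 (V j) \<subseteq> col j" if "j < q" for j
  proof
    fix t assume t: "t \<in> hit (eta D) y1 y2 (V j)"
    then have "t < q" using wf by (auto simp: hit_def well_formed_def q_def)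
    obtain R where R: "R \<in> V j" "y1 R \<le> eta D ! t" "eta D ! t < y2 R"
      using t by (auto simp: hit_def)
    then have "j * q + t \<in> N"
      unfolding N_def hit_def using new_marker[OF that \<open>t < q\<close>]
      by (auto intro!: bexI[of _ "V_copy M (xi D ! j) R"] simp: V_copy_def V_def)
    with \<open>t < q\<close> show "t \<in> col j" by (simp add: col_def)
  qed
  have fin_col: "finite (col j)" for j by (simp add: col_def)
  have col_bound: "card {i. i < q \<and> j \<in> A i} + card (V j) \<le> card (col j)" if "j < q" for j
  proof (cases "\<exists>i<q. j \<in> A i")
    case True
    then have "col j = {..<q}" using col_full that by blast
    have "card {i. i < q \<and> j \<in> A i} + card (B j) = card ({i. i < q \<and> j \<in> A i} \<union> B j)"
      using no_cross that by (intro card_Un_disjoint[symmetric]) (auto simp: B_def)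
    also have "\<dots> \<le> card {..<q}"
      using hit_subset[of "xi D"] by (intro card_mono) (auto simp: B_def q_def)
    finally show ?thesis
      using card_V(1)[of j] \<open>col j = {..<q}\<close> by simp
  next
    case False
    then have "{i. i < q \<and> j \<in> A i} = {}" by blast
    with card_V(2)[of j] card_mono[OF fin_col col_V[OF that]] show ?thesis
      unfolding \<open>{i. i < q \<and> j \<in> A i} = {}\<close> by simp
  qed

  have "S \<subseteq> (\<Union>i<q. H_copy M (xi D ! i) ` H i) \<union> (\<Union>j<q. V_copy M (xi D ! j) ` V j)"
  proof
    fix Q assume "Q \<in> S"
    then obtain k R where "k < q" "R \<in> rects D" "Q = H_copy M (xi D ! k) R \<or> Q = V_copy M (xi D ! k) R"
      using S(1) by (auto simp: crossbar_sel q_def M_def)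
    with \<open>Q \<in> S\<close> show "Q \<in> (\<Union>i<q. H_copy M (xi D ! i) ` H i) \<union> (\<Union>j<q. V_copy M (xi D ! j) ` V j)"
      by (auto simp: H_def V_def)
  qed
  then have "card S \<le> card ((\<Union>i<q. H_copy M (xi D ! i) ` H i) \<union> (\<Union>j<q. V_copy M (xi D ! j) ` V j))"
    using fin by (intro card_mono) (auto simp: H_def V_def)
  also have "\<dots> \<le> (\<Sum>i<q. card (H i)) + (\<Sum>j<q. card (V j))"
    using fin by (intro order.trans[OF card_Un_le] add_mono order.trans[OF card_UN_le] sum_mono card_image_le)
      (auto simp: H_def V_def)
  also have "\<dots> \<le> (\<Sum>i<q. card (A i)) + (\<Sum>j<q. card (V j))"
    using card_H by (intro add_right_mono sum_mono)
  also have "(\<Sum>i<q. card (A i)) = (\<Sum>i<q. \<Sum>j<q. of_bool (j \<in> A i))"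
  proof (rule sum.cong[OF refl])
    fix i
    have "A i = {..<q} \<inter> {j. j \<in> A i}"
      using hit_subset[of "xi D"] by (auto simp: A_def q_def)
    then show "card (A i) = (\<Sum>j<q. of_bool (j \<in> A i))"
      by (simp add: sum_of_bool_eq)
  qed
  also have "\<dots> = (\<Sum>j<q. card {i. i < q \<and> j \<in> A i})"
    by (subst sum.swap) (simp add: sum_of_bool_eq Int_def)
  also have "\<dots> + (\<Sum>j<q. card (V j)) = (\<Sum>j<q. card {i. i < q \<and> j \<in> A i} + card (V j))"
    by (simp add: sum.distrib)
  also have "\<dots> \<le> (\<Sum>j<q. card (col j))"
    using col_bound by (intro sum_mono) auto
  also have "\<dots> = card (SIGMA j:{..<q}. col j)"
    using fin_col by simp
  also have "\<dots> \<le> card N"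
  proof (rule card_inj_on_le)
    show "inj_on (\<lambda>(j, t). j * q + t) (SIGMA j:{..<q}. col j)"
    proof (rule inj_onI, clarsimp)
      fix j t j' t' assume *: "t \<in> col j" "t' \<in> col j'" "j * q + t = j' * q + t'"
      then have "t < q" "t' < q" by (auto simp: col_def)
      then have "(j * q + t) div q = j" "(j' * q + t') div q = j'" by simp_all
      with * show "j = j' \<and> t = t'" by simp
    qed
    show "(\<lambda>(j, t). j * q + t) ` (SIGMA j:{..<q}. col j) \<subseteq> N"
      by (auto simp: col_def)
    show "finite N" by (simp add: N_def)
  qed
  finally show ?thesis unfolding N_def .
qed

lemma marker_bounded_crossbar:
  assumes wf: "well_formed D" and mb: "marker_bounded D"
  shows "marker_bounded (crossbar D)"
  unfolding marker_bounded_def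
proof (intro allI impI conjI)
  fix S assume S: "S \<subseteq> rects (crossbar D)" "independent S"
  show "card S \<le> card (hit (xi (crossbar D)) x1 x2 S)"
    using assms S by (rule crossbar_vertical_hits)
  have "card S = card (transposed ` S)"
    by (intro card_image[symmetric] inj_onI) (simp add: transposed_inject)
  also have "\<dots> \<le> card (hit (xi (crossbar D)) x1 x2 (transposed ` S))"
    using S rects_crossbar_transposed[of D]
    by (intro crossbar_vertical_hits assms independent_transposed) blast+
  also have "hit (xi (crossbar D)) x1 x2 (transposed ` S) = hit (eta (crossbar D)) y1 y2 S"
    by (simp add: hit_def crossbar_sel(4))
  finally show "card S \<le> card (hit (eta (crossbar D)) y1 y2 S)" .
qed

lemma marker_bounded_nu_le:
  assumes wf: "well_formed D" and mb: "marker_bounded D"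
  shows "nu (rects D) \<le> length (xi D)"
proof -
  let ?C = "{card S | S. S \<subseteq> rects D \<and> independent S}"
  have fin: "finite (rects D)" using wf by (simp add: well_formed_def)
  have "n \<le> length (xi D)" if "n \<in> ?C" for n
  proof -
    from that obtain S where "n = card S" "S \<subseteq> rects D" "independent S" by blast
    then have "n \<le> card (hit (xi D) x1 x2 S)"
      using mb by (simp add: marker_bounded_def)
    also have "\<dots> \<le> card {..<length (xi D)}"
      by (intro card_mono hit_subset) auto
    finally show ?thesis by simp
  qed
  moreover have "finite ?C"
    using fin by (intro finite_subset[OF _ finite_imageI[of "Pow (rects D)" card]]) auto
  moreover have "card {} \<in> ?C"
    by (intro CollectI exI[of _ "{}"]) (simp add: independent_def)
  ultimately show ?thesis
    unfolding nu_def independent_def[symmetric] by (intro Max.boundedI) auto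
qed

lemma nu_pos:
  assumes "finite F" "F \<noteq> {}"
  shows "nu F > 0"
proof -
  let ?C = "{card S | S. S \<subseteq> F \<and> independent S}"
  obtain R where "R \<in> F" using assms by blast
  then have "card {R} \<in> ?C"
    by (intro CollectI exI[of _ "{R}"]) (simp add: independent_def)
  moreover have "finite ?C"
    using assms by (intro finite_subset[OF _ finite_imageI[of "Pow F" card]]) auto
  ultimately have "card {R} \<le> nu F"
    unfolding nu_def independent_def[symmetric] by (intro Max_ge)
  then show ?thesis by simp
qed

section \<open>Fractional weights\<close>

definition load :: "rect set \<Rightarrow> (rect \<Rightarrow> real) \<Rightarrow> real \<times> real \<Rightarrow> real" where
  "load F w p = (\<Sum>R\<in>F. of_bool (p \<in> region R) * w R)"

text \<open>The three functions bound the load on the vertical markers, on the horizontal markers, and at the crossings of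
markers. They are indexed by marker numbers, since it is the numbering that the crossbar step refines.\<close>

definition admissible ::
  "drawing \<Rightarrow> (rect \<Rightarrow> real) \<Rightarrow> (nat \<Rightarrow> real) \<Rightarrow> (nat \<Rightarrow> real) \<Rightarrow> (nat \<Rightarrow> nat \<Rightarrow> real) \<Rightarrow> bool" where
  "admissible D w vc hc cc \<longleftrightarrow>
     (\<forall>R\<in>rects D. 0 \<le> w R) \<and>
     (\<forall>p. load (rects D) w p \<le> 1) \<and>
     (\<forall>k<length (xi D). \<forall>Y. load (rects D) w (xi D ! k, Y) \<le> vc k) \<and>
     (\<forall>l<length (eta D). \<forall>X. load (rects D) w (X, eta D ! l) \<le> hc l) \<and>
     (\<forall>k<length (xi D). \<forall>l<length (eta D). load (rects D) w (xi D ! k, eta D ! l) \<le> cc k l)"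

lemma alpha_star_ge:
  assumes wf: "well_formed D" and ad: "admissible D w vc hc cc"
  shows "(\<Sum>R\<in>rects D. w R) \<le> alpha_star (rects D)"
proof -
  have fin: "finite (rects D)" using wf by (simp add: well_formed_def)
  have "region R \<noteq> {}" if "R \<in> rects D" for R
    using wf that by (auto simp: well_formed_def region_def)
  moreover have "(\<Sum>R | R \<in> rects D \<and> p \<in> region R. w R) = load (rects D) w p" for p
    using fin by (simp add: load_def sum.inter_filter of_bool_def if_distrib[of "\<lambda>c. c * _"] cong: if_cong)
  ultimately have "clique_feasible (rects D) (intersection_edges (rects D)) w"
    using ad fin by (subst clique_feasible_iff_point_feasible) (auto simp: admissible_def)
  then show ?thesis
    unfolding alpha_star_def graph_alpha_star_def
    using fin by (intro cSup_upper graph_alpha_star_values) auto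
qed

lemma sum_pushforward:
  fixes g h :: "_ \<Rightarrow> real"
  assumes "finite S" "finite T" "f ` S \<subseteq> T"
  shows "(\<Sum>y\<in>T. g y * (\<Sum>x | x \<in> S \<and> f x = y. h x)) = (\<Sum>x\<in>S. g (f x) * h x)"
proof -
  have "(\<Sum>y\<in>T. g y * (\<Sum>x | x \<in> S \<and> f x = y. h x)) =
      (\<Sum>y\<in>T. \<Sum>x | x \<in> S \<and> f x = y. g (f x) * h x)"
    by (simp add: sum_distrib_left)
  also have "\<dots> = (\<Sum>x\<in>S. g (f x) * h x)"
    using assms by (rule sum.group)
  finally show ?thesis .
qed

text \<open>The weight of a rectangle is collected over all copies that produce it. Totals and loads of a crossbar are
then sums over copies, whether or not different copies coincide.\<close>

definition crossbar_weight ::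
  "drawing \<Rightarrow> (nat \<Rightarrow> rect \<Rightarrow> real) \<Rightarrow> (nat \<Rightarrow> rect \<Rightarrow> real) \<Rightarrow> rect \<Rightarrow> real" where
  "crossbar_weight D h v Q =
     (\<Sum>(i, R) | (i, R) \<in> {..<length (xi D)} \<times> rects D \<and> H_copy (side D + 1) (xi D ! i) R = Q. h i R) +
     (\<Sum>(j, R) | (j, R) \<in> {..<length (xi D)} \<times> rects D \<and> V_copy (side D + 1) (xi D ! j) R = Q. v j R)"

lemma sum_crossbar_weight:
  assumes "finite (rects D)"
  shows "(\<Sum>Q\<in>rects (crossbar D). g Q * crossbar_weight D h v Q) =
    (\<Sum>i<length (xi D). \<Sum>R\<in>rects D. g (H_copy (side D + 1) (xi D ! i) R) * h i R) +
    (\<Sum>j<length (xi D). \<Sum>R\<in>rects D. g (V_copy (side D + 1) (xi D ! j) R) * v j R)"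
proof -
  let ?S = "{..<length (xi D)} \<times> rects D"
  have fin: "finite ?S" "finite (rects (crossbar D))"
    using assms by (auto simp: crossbar_sel)
  have *: "(\<Sum>Q\<in>rects (crossbar D). g Q * (\<Sum>(i, R) | (i, R) \<in> ?S \<and> c i R = Q. u i R)) =
      (\<Sum>i<length (xi D). \<Sum>R\<in>rects D. g (c i R) * u i R)"
    if "\<And>i R. i < length (xi D) \<Longrightarrow> R \<in> rects D \<Longrightarrow> c i R \<in> rects (crossbar D)"
    for c :: "nat \<Rightarrow> rect \<Rightarrow> rect" and u
    using sum_pushforward[of ?S "rects (crossbar D)" "\<lambda>(i, R). c i R" g "\<lambda>(i, R). u i R"] fin that
    by (auto simp: sum.cartesian_product case_prod_unfold image_subset_iff mem_Times_iff)
  show ?thesis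
    unfolding crossbar_weight_def distrib_left sum.distrib
    by (intro arg_cong2[of _ _ _ _ "(+)"] *) (auto simp: crossbar_sel)
qed

text \<open>The load of the rows at a point. A column is a transposed row, so the load of the columns at $(X,Y)$ is
that of rows with the same weights at $(Y,X)$.\<close>

definition band_load :: "drawing \<Rightarrow> (nat \<Rightarrow> rect \<Rightarrow> real) \<Rightarrow> real \<Rightarrow> real \<Rightarrow> real" where
  "band_load D h X Y = (\<Sum>i<length (xi D).
     load (rects D) (h i) (X / (side D + 1), Y - (side D + 1) * xi D ! i))"

lemma load_crossbar:
  assumes "well_formed D"
  shows "load (rects (crossbar D)) (crossbar_weight D h v) (X, Y) =
    band_load D h X Y + band_load D v Y X"
proof -
  have "side D + 1 > 0" "finite (rects D)" using assms by (auto simp: well_formed_def)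
  then show ?thesis
    by (simp add: load_def band_load_def sum_crossbar_weight region_copies)
qed

text \<open>At a point of column band $j$, the old drawing that a row displays is met at a horizontal coordinate in
$[\xi_j, \xi_j + 1)$. A rectangle with integer coordinates that reaches this point also contains the
point on the marker $\xi_j$ itself.\<close>

lemma load_snap_to_marker:
  assumes wf: "well_formed D" and w: "\<forall>R\<in>rects D. 0 \<le> w R"
    and a: "a \<in> \<int>" and s: "0 \<le> s" "s \<le> side D"
  shows "load (rects D) w (((side D + 1) * a + s) / (side D + 1), Y) \<le> load (rects D) w (a, Y)"
proof -
  have "(a, Y) \<in> region R"
    if "R \<in> rects D" "(((side D + 1) * a + s) / (side D + 1), Y) \<in> region R" for R
  proof -
    have "side D + 1 > 0" using wf by (simp add: well_formed_def)
    then have "((side D + 1) * a + s) / (side D + 1) < a + 1"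
      "a \<le> ((side D + 1) * a + s) / (side D + 1)"
      using s by (simp_all add: field_simps)
    then have "a \<le> x2 R" "x1 R < a + 1" using that by (auto simp: region_def)
    moreover have "x1 R \<in> \<int>" using wf that by (simp add: well_formed_def)
    ultimately show ?thesis
      using that a Ints_less_iff_add1_le[of a "x1 R"] by (auto simp: region_def)
  qed
  then show ?thesis
    unfolding load_def using w by (intro sum_mono mult_right_mono) auto
qed

lemma band_load_in_band:
  assumes wf: "well_formed D" and i: "i < length (xi D)" and s: "0 \<le> s" "s \<le> side D"
  shows "band_load D h X ((side D + 1) * xi D ! i + s) = load (rects D) (h i) (X / (side D + 1), s)"
proof -
  have "load (rects D) (h i') (X / (side D + 1), (side D + 1) * xi D ! i + s - (side D + 1) * xi D ! i') = 0"
    if i': "i' \<in> {..<length (xi D)} - {i}" for i'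
  proof -
    have "False" if R: "R \<in> rects D"
      "(X / (side D + 1), (side D + 1) * xi D ! i + s - (side D + 1) * xi D ! i') \<in> region R" for R
    proof -
      define t where "t = (side D + 1) * xi D ! i + s - (side D + 1) * xi D ! i'"
      have "0 \<le> t" "t \<le> side D" using R wf by (auto simp: region_def well_formed_def t_def)
      moreover have "(side D + 1) * xi D ! i + s = (side D + 1) * xi D ! i' + t"
        by (simp add: t_def)
      moreover have "xi D ! i \<in> \<int>" "xi D ! i' \<in> \<int>"
        using wf i i' by (auto simp: well_formed_def)
      ultimately have "xi D ! i = xi D ! i'"
        using unique_integer_part[of "xi D ! i" "xi D ! i'" s "side D + 1" t] s by simp
      then show False
        using wf i i' by (auto simp: well_formed_def nth_eq_iff_index_eq)
    qed
    then show ?thesis unfolding load_def by (intro sum.neutral) auto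
  qed
  then show ?thesis
    using i unfolding band_load_def by (subst sum.remove[of _ i]) auto
qed

lemma band_load_cases:
  assumes wf: "well_formed D"
  obtains i s where "i < length (xi D)" "0 \<le> s" "s \<le> side D" "Y = (side D + 1) * xi D ! i + s"
  | "\<And>h X. band_load D h X Y = 0"
proof (cases "\<exists>i<length (xi D). 0 \<le> Y - (side D + 1) * xi D ! i \<and> Y - (side D + 1) * xi D ! i \<le> side D")
  case True
  then obtain i where "i < length (xi D)" "0 \<le> Y - (side D + 1) * xi D ! i"
    "Y - (side D + 1) * xi D ! i \<le> side D" by blast
  then show thesis using that(1)[of i "Y - (side D + 1) * xi D ! i"] by simp
next
  case False
  have "load (rects D) w (X, Y - (side D + 1) * xi D ! i) = 0" if "i < length (xi D)" for w X i
    unfolding load_def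
  proof (intro sum.neutral ballI)
    fix R assume "R \<in> rects D"
    then have "0 \<le> y1 R" "y2 R \<le> side D" using wf by (simp_all add: well_formed_def)
    moreover have "\<not> (0 \<le> Y - (side D + 1) * xi D ! i \<and> Y - (side D + 1) * xi D ! i \<le> side D)"
      using False that by blast
    ultimately have "(X, Y - (side D + 1) * xi D ! i) \<notin> region R"
      unfolding region_def mem_Times_iff fst_conv snd_conv atLeastAtMost_iff by linarith
    then show "of_bool ((X, Y - (side D + 1) * xi D ! i) \<in> region R) * w R = 0" by simp
  qed
  then show thesis using that(2) by (simp add: band_load_def)
qed

text \<open>On the new vertical marker $(j,t)$, the column $j$ shows its load along the old horizontal marker $t$. Outside
the rows nothing else is present; inside row $i$ the column is met at the crossing of the vertical marker $i$
and the horizontal marker $t$, while the row adds its load on the vertical marker $j$. With rows and columns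
exchanged, this also covers the horizontal markers.\<close>

lemma crossbar_vertical_marker_load:
  assumes wf: "well_formed D"
    and h: "\<And>i. i < length (xi D) \<Longrightarrow> admissible D (h i) (vh i) (hh i) (ch i)"
    and v: "\<And>j. j < length (xi D) \<Longrightarrow> admissible D (v j) (vv j) (hv j) (cv j)"
    and j: "j < length (xi D)" and t: "t < length (xi D)"
    and alone: "hv j t \<le> c"
    and meet: "\<And>i. i < length (xi D) \<Longrightarrow> vh i j + cv j i t \<le> c"
  shows "band_load D h ((side D + 1) * xi D ! j + eta D ! t) Y +
         band_load D v Y ((side D + 1) * xi D ! j + eta D ! t) \<le> c"
proof -
  have len: "length (eta D) = length (xi D)" using wf by (simp add: well_formed_def)
  have "xi D ! j \<in> set (xi D)" "eta D ! t \<in> set (eta D)" using j t len by simp_all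
  then have xi: "xi D ! j \<in> \<int>" and eta: "0 \<le> eta D ! t" "eta D ! t \<le> side D"
    using wf by (auto simp: well_formed_def)
  have V: "band_load D v Y ((side D + 1) * xi D ! j + eta D ! t) =
      load (rects D) (v j) (Y / (side D + 1), eta D ! t)"
    using wf j eta by (rule band_load_in_band)
  show ?thesis
  proof (cases rule: band_load_cases[OF wf, of Y])
    case (1 i s)
    have "xi D ! i \<in> \<int>" using wf 1 by (auto simp: well_formed_def)
    have "band_load D h ((side D + 1) * xi D ! j + eta D ! t) Y =
        load (rects D) (h i) (((side D + 1) * xi D ! j + eta D ! t) / (side D + 1), s)"
      using 1 wf by (simp add: band_load_in_band)
    also have "\<dots> \<le> load (rects D) (h i) (xi D ! j, s)"
      using h[OF \<open>i < _\<close>] wf xi eta by (intro load_snap_to_marker) (auto simp: admissible_def)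
    also have "\<dots> \<le> vh i j"
      using h[OF \<open>i < _\<close>] j by (simp add: admissible_def)
    finally have "band_load D h ((side D + 1) * xi D ! j + eta D ! t) Y \<le> vh i j" .
    moreover have "load (rects D) (v j) (Y / (side D + 1), eta D ! t) \<le> load (rects D) (v j) (xi D ! i, eta D ! t)"
      unfolding 1(4) using v[OF j] wf \<open>xi D ! i \<in> \<int>\<close> 1
      by (intro load_snap_to_marker) (auto simp: admissible_def)
    moreover have "load (rects D) (v j) (xi D ! i, eta D ! t) \<le> cv j i t"
      using v[OF j] t 1 len by (simp add: admissible_def)
    ultimately show ?thesis
      using meet[OF \<open>i < _\<close>] V by simp
  next
    case 2
    have "load (rects D) (v j) (Y / (side D + 1), eta D ! t) \<le> hv j t"
      using v[OF j] t len by (simp add: admissible_def)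
    with 2 V alone show ?thesis by simp
  qed
qed

text \<open>Marker $k$ of the crossbar is the pair $(k \mathbin{\mathrm{div}} q,\ k \bmod q)$. At the crossing of the vertical
marker $(j,t)$ with the horizontal marker $(i,s)$, only row $i$ and column $j$ are present: the row is met at
the crossing of $j$ and $s$, and the column at that of $i$ and $t$.\<close>

lemma admissible_crossbar:
  fixes D h v
  defines "q \<equiv> length (xi D)"
  assumes wf: "well_formed D"
    and h: "\<And>i. i < q \<Longrightarrow> admissible D (h i) (vh i) (hh i) (ch i)"
    and v: "\<And>j. j < q \<Longrightarrow> admissible D (v j) (vv j) (hv j) (cv j)"
    and crossing: "\<And>i j. i < q \<Longrightarrow> j < q \<Longrightarrow> vh i j + vv j i \<le> 1"
    and vc: "\<And>k. k < q\<^sup>2 \<Longrightarrow> hv (k div q) (k mod q) \<le> vc k"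
      "\<And>i k. i < q \<Longrightarrow> k < q\<^sup>2 \<Longrightarrow> vh i (k div q) + cv (k div q) i (k mod q) \<le> vc k"
    and hc: "\<And>l. l < q\<^sup>2 \<Longrightarrow> hh (l div q) (l mod q) \<le> hc l"
      "\<And>j l. j < q \<Longrightarrow> l < q\<^sup>2 \<Longrightarrow> vv j (l div q) + ch (l div q) j (l mod q) \<le> hc l"
    and cc: "\<And>k l. k < q\<^sup>2 \<Longrightarrow> l < q\<^sup>2 \<Longrightarrow>
      ch (l div q) (k div q) (l mod q) + cv (k div q) (l div q) (k mod q) \<le> cc k l"
  shows "admissible (crossbar D) (crossbar_weight D h v) vc hc cc"
proof -
  have len: "length (eta D) = q" "length (xi (crossbar D)) = q\<^sup>2" "length (eta (crossbar D)) = q\<^sup>2"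
    using wf length_xi_crossbar[OF wf] by (simp_all add: well_formed_def q_def crossbar_sel(4))
  have split: "k div q < q" "k mod q < q" if "k < q\<^sup>2" for k
  proof -
    have "0 < q" using that by (cases "q = 0") auto
    then show "k div q < q" "k mod q < q"
      using that by (simp_all add: power2_eq_square less_mult_imp_div_less)
  qed
  have xi: "xi D ! k \<in> \<int>" and eta: "0 \<le> eta D ! k" "eta D ! k \<le> side D" if "k < q" for k
  proof -
    have "xi D ! k \<in> set (xi D)" "eta D ! k \<in> set (eta D)"
      using that len by (simp_all add: q_def)
    then show "xi D ! k \<in> \<int>" "0 \<le> eta D ! k" "eta D ! k \<le> side D"
      using wf by (auto simp: well_formed_def)
  qed
  have nonneg: "\<forall>R\<in>rects D. 0 \<le> h i R" "\<forall>R\<in>rects D. 0 \<le> v i R" if "i < q" for i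
    using h[OF that] v[OF that] by (auto simp: admissible_def)
  have "0 \<le> crossbar_weight D h v R" for R
    unfolding crossbar_weight_def using nonneg
    by (intro add_nonneg_nonneg sum_nonneg) (auto simp: q_def)
  moreover have "band_load D h X Y + band_load D v Y X \<le> 1" for X Y
  proof (cases rule: band_load_cases[OF wf, of Y])
    case i: (1 i s)
    show ?thesis
    proof (cases rule: band_load_cases[OF wf, of X])
      case j: (1 j t)
      have "band_load D h X Y \<le> load (rects D) (h i) (xi D ! j, s)"
        unfolding i(4) j(4) using wf i j nonneg[of i] xi[of j]
        by (subst band_load_in_band) (auto intro!: load_snap_to_marker simp: q_def)
      moreover have "band_load D v Y X \<le> load (rects D) (v j) (xi D ! i, t)"
        unfolding i(4) j(4) using wf i j nonneg[of j] xi[of i]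
        by (subst band_load_in_band) (auto intro!: load_snap_to_marker simp: q_def)
      moreover have "load (rects D) (h i) (xi D ! j, s) \<le> vh i j"
        "load (rects D) (v j) (xi D ! i, t) \<le> vv j i"
        using h[of i] v[of j] i j by (auto simp: admissible_def q_def)
      ultimately show ?thesis using crossing[of i j] i j by (simp add: q_def)
    next
      case 2
      then show ?thesis
        using h[of i] i wf band_load_in_band[OF wf, of i s] by (simp add: admissible_def q_def)
    qed
  next
    case Y: 2
    show ?thesis
    proof (cases rule: band_load_cases[OF wf, of X])
      case (1 j t)
      then show ?thesis
        using v[of j] Y wf band_load_in_band[OF wf, of j t] by (simp add: admissible_def q_def)
    qed (use Y in simp)
  qed
  moreover have "band_load D h (xi (crossbar D) ! k) Y + band_load D v Y (xi (crossbar D) ! k) \<le> vc k"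
    if k: "k < q\<^sup>2" for k Y
    using crossbar_vertical_marker_load[where h = h and v = v, OF wf h v] split[OF k] vc k
    by (simp add: nth_xi_crossbar[OF wf] q_def)
  moreover have "band_load D v (xi (crossbar D) ! l) X + band_load D h X (xi (crossbar D) ! l) \<le> hc l"
    if l: "l < q\<^sup>2" for l X
    using crossbar_vertical_marker_load[where h = v and v = h, OF wf v h] split[OF l] hc l
    by (simp add: nth_xi_crossbar[OF wf] q_def)
  moreover have "band_load D h (xi (crossbar D) ! k) (xi (crossbar D) ! l) +
      band_load D v (xi (crossbar D) ! l) (xi (crossbar D) ! k) \<le> cc k l"
    if k: "k < q\<^sup>2" and l: "l < q\<^sup>2" for k l
  proof -
    \<comment> \<open>rows and columns share the marker list, so one estimate serves both\<close>
    have *: "band_load D u (xi (crossbar D) ! k) (xi (crossbar D) ! l) \<le> c (l div q) (k div q) (l mod q)"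
      if "k < q\<^sup>2" "l < q\<^sup>2" "\<And>i. i < q \<Longrightarrow> admissible D (u i) (b i) (d i) (c i)" for k l u b c d
    proof -
      have "band_load D u (xi (crossbar D) ! k) (xi (crossbar D) ! l) \<le>
          load (rects D) (u (l div q)) (xi D ! (k div q), eta D ! (l mod q))"
        using split[OF that(1)] split[OF that(2)] that wf xi eta
        by (simp add: nth_xi_crossbar[OF wf] q_def band_load_in_band)
          (intro load_snap_to_marker; auto simp: admissible_def q_def)
      also have "\<dots> \<le> c (l div q) (k div q) (l mod q)"
        using split[OF that(1)] split[OF that(2)] that(3) len by (simp add: admissible_def q_def)
      finally show ?thesis .
    qed
    show ?thesis
      using *[of k l h, OF k l h] *[of l k v, OF l k v] cc[OF k l] by simp
  qed
  ultimately show ?thesis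
    unfolding admissible_def len
    by (auto simp: load_crossbar[OF wf] crossbar_sel(4) add.commute[of "band_load D h _ _"])
qed

section \<open>The base drawing\<close>

lemma well_formed_base: "well_formed P_base"
  by (simp add: well_formed_def P_base_def)

text \<open>An independent set contains at most one of the two rectangles at height 20, and at most two of the 5-cycle.
Encoding membership by eight truth values reduces the claim to propositional reasoning from the six edges of the
intersection graph.\<close>

lemma marker_bounded_base: "marker_bounded P_base"
  unfolding marker_bounded_def
proof (intro allI impI)
  fix S assume S: "S \<subseteq> rects P_base" "independent S"
  define t ul ur c0 c1 c2 c3 q where bools:
    "t \<longleftrightarrow> Rect 0 30 26 28 \<in> S" "ul \<longleftrightarrow> Rect 0 16 20 22 \<in> S" "ur \<longleftrightarrow> Rect 14 30 20 22 \<in> S"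
    "c0 \<longleftrightarrow> Rect 0 8 2 10 \<in> S" "c1 \<longleftrightarrow> Rect 6 16 8 14 \<in> S" "c2 \<longleftrightarrow> Rect 14 24 8 14 \<in> S"
    "c3 \<longleftrightarrow> Rect 22 30 2 12 \<in> S" "q \<longleftrightarrow> Rect 6 24 0 4 \<in> S"
  have apart: "\<not> (R \<in> S \<and> R' \<in> S)"
    if "R \<noteq> R'" "x1 R \<le> x1 R'" "x1 R' \<le> x2 R" "x1 R' \<le> x2 R'" "max (y1 R) (y1 R') \<le> min (y2 R) (y2 R')" for R R'
  proof
    assume "R \<in> S \<and> R' \<in> S"
    then have "disjnt (region R) (region R')"
      using S(2) that by (auto simp: independent_def pairwise_def)
    moreover have "(x1 R', max (y1 R) (y1 R')) \<in> region R \<inter> region R'"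
      using that by (auto simp: region_def)
    ultimately show False by (auto simp: disjnt_def)
  qed
  have edges: "\<not> (ul \<and> ur)" "\<not> (c0 \<and> c1)" "\<not> (c1 \<and> c2)" "\<not> (c2 \<and> c3)" "\<not> (q \<and> c3)" "\<not> (c0 \<and> q)"
    unfolding bools by (intro apart; simp)+
  have fin: "finite (rects P_base)" by (simp add: P_base_def)
  have "S = {R \<in> rects P_base. R \<in> S}" using S(1) by blast
  then have "card S = (\<Sum>R\<in>rects P_base. of_bool (R \<in> S))"
    using fin by (simp add: sum_of_bool_eq Int_def)
  then have card_S: "card S = of_bool t + of_bool ul + of_bool ur + of_bool c0 + of_bool c1 +
      of_bool c2 + of_bool c3 + of_bool q"
    by (simp add: P_base_def bools)
  have card_hit: "card (hit [a, b, c, d] lo hi S) = of_bool (\<exists>R\<in>S. lo R \<le> a \<and> a < hi R) +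
      of_bool (\<exists>R\<in>S. lo R \<le> b \<and> b < hi R) + of_bool (\<exists>R\<in>S. lo R \<le> c \<and> c < hi R) +
      of_bool (\<exists>R\<in>S. lo R \<le> d \<and> d < hi R)" for a b c d lo hi
  proof -
    have "hit [a, b, c, d] lo hi S = {..<4} \<inter> {k. \<exists>R\<in>S. lo R \<le> [a, b, c, d] ! k \<and> [a, b, c, d] ! k < hi R}"
      by (auto simp: hit_def)
    then have "card (hit [a, b, c, d] lo hi S) =
        (\<Sum>k<4. of_bool (\<exists>R\<in>S. lo R \<le> [a, b, c, d] ! k \<and> [a, b, c, d] ! k < hi R))"
      by (simp add: sum_of_bool_eq)
    then show ?thesis by (simp add: numeral_eq_Suc)
  qed
  have ex_S: "(\<exists>R\<in>S. P R) \<longleftrightarrow> (\<exists>R\<in>rects P_base. R \<in> S \<and> P R)" for P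
    using S(1) by blast
  have "card (hit (xi P_base) x1 x2 S) = of_bool (t \<or> ul \<or> c0) + of_bool (t \<or> ul \<or> c1 \<or> q) +
      of_bool (t \<or> ur \<or> c2 \<or> q) + of_bool (t \<or> ur \<or> c3)"
    unfolding ex_S by (simp add: P_base_def card_hit ex_S bools)
  moreover have "card (hit (eta P_base) y1 y2 S) = of_bool (c0 \<or> c3 \<or> q) + of_bool (c1 \<or> c2 \<or> c3) +
      of_bool (ul \<or> ur) + of_bool t"
    unfolding ex_S by (simp add: P_base_def card_hit ex_S bools)
  ultimately show "card S \<le> card (hit (xi P_base) x1 x2 S) \<and> card S \<le> card (hit (eta P_base) y1 y2 S)"
    unfolding card_S using edges by (auto simp: of_bool_def)
qed

text \<open>Low markers of the base drawing are the horizontal ones at 3 and 11. As $q$ is a power of 4, the index of the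
new marker $(j,t)$ is congruent to $t$ modulo 4, so a marker is low when its innermost component is.\<close>

definition low :: "nat \<Rightarrow> bool" where
  "low k \<longleftrightarrow> k mod 4 < 2"

text \<open>The rectangles whose upper edge is at height 14 or below are those of the 5-cycle.\<close>

definition base_weight :: "real \<Rightarrow> real \<Rightarrow> rect \<Rightarrow> real" where
  "base_weight a b R = (if y2 R \<le> 14 then a else b)"

lemma sum_base_weight: "(\<Sum>R\<in>rects P_base. base_weight a b R) = 5 * a + 3 * b"
  by (simp add: P_base_def base_weight_def)

text \<open>At most two rectangles share a point, as the 5-cycle has no triangle, and the rectangles that meet a vertical
marker are pairwise disjoint. This is the strength of the base drawing: the load on its vertical markers is at most half
of what is possible elsewhere. A low horizontal marker meets only the 5-cycle, a high one only the other three.\<close>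

lemma admissible_base:
  assumes a: "0 \<le> a" "a \<le> 1 / 2" and b: "0 \<le> b" "b \<le> 1 / 2"
  shows "admissible P_base (base_weight a b) (\<lambda>_. max a b)
    (\<lambda>l. 2 * (if low l then a else b)) (\<lambda>_ l. if low l then a else b)"
proof -
  define cycle :: "real \<Rightarrow> real \<Rightarrow> real" where "cycle X Y =
    of_bool (0 \<le> X \<and> X \<le> 8 \<and> 2 \<le> Y \<and> Y \<le> 10) + of_bool (6 \<le> X \<and> X \<le> 16 \<and> 8 \<le> Y \<and> Y \<le> 14) +
    of_bool (14 \<le> X \<and> X \<le> 24 \<and> 8 \<le> Y \<and> Y \<le> 14) + of_bool (22 \<le> X \<and> X \<le> 30 \<and> 2 \<le> Y \<and> Y \<le> 12) +
    of_bool (6 \<le> X \<and> X \<le> 24 \<and> 0 \<le> Y \<and> Y \<le> 4)" for X Y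
  define top :: "real \<Rightarrow> real \<Rightarrow> real" where "top X Y =
    of_bool (0 \<le> X \<and> X \<le> 30 \<and> 26 \<le> Y \<and> Y \<le> 28) + of_bool (0 \<le> X \<and> X \<le> 16 \<and> 20 \<le> Y \<and> Y \<le> 22) +
    of_bool (14 \<le> X \<and> X \<le> 30 \<and> 20 \<le> Y \<and> Y \<le> 22)" for X Y
  have load: "load (rects P_base) (base_weight a b) (X, Y) = cycle X Y * a + top X Y * b" for X Y
    by (simp add: load_def P_base_def base_weight_def region_def cycle_def top_def algebra_simps
        del: sum_of_bool_mult_eq sum_mult_of_bool_eq)
  have pos: "0 \<le> cycle X Y" "0 \<le> top X Y" for X Y
    by (simp_all add: cycle_def top_def)
  have cycle_le: "cycle X Y \<le> 2" for X Y
    unfolding cycle_def of_bool_def by (simp split: if_split)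
  have top_le: "top X Y \<le> 2" for X Y
    unfolding top_def of_bool_def by (simp split: if_split)
  have below: "top X Y = 0" if "Y \<le> 14" for X Y
    using that by (simp add: top_def)
  have above: "cycle X Y = 0" if "14 < Y" for X Y
    using that by (simp add: cycle_def)
  have column: "cycle X Y \<le> 1 \<and> top X Y \<le> 1" if "X \<in> set (xi P_base)" for X Y
    using that unfolding cycle_def top_def of_bool_def by (auto simp: P_base_def)
  have combine: "cycle X Y * a + top X Y * b \<le> n * max a b" if "cycle X Y \<le> n" "top X Y \<le> n" for X Y n
  proof (cases "Y \<le> 14")
    case True
    have "cycle X Y * a \<le> n * max a b" using that a pos[of X Y] by (intro mult_mono) auto
    with True show ?thesis by (simp add: below)
  next
    case False
    have "top X Y * b \<le> n * max a b" using that b pos[of X Y] by (intro mult_mono) auto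
    with False show ?thesis by (simp add: above)
  qed
  have row: "cycle X (eta P_base ! l) * a + top X (eta P_base ! l) * b \<le> n * (if low l then a else b)"
    if "l < 4" "cycle X (eta P_base ! l) \<le> n" "top X (eta P_base ! l) \<le> n" for l X n
  proof -
    have "(if low l then eta P_base ! l \<le> 14 else 14 < eta P_base ! l)"
    proof -
      from \<open>l < 4\<close> consider "l = 0" | "l = 1" | "l = 2" | "l = 3" by linarith
      then show ?thesis by cases (simp_all add: low_def P_base_def)
    qed
    then show ?thesis
      using that(2,3) a b by (auto simp: below above intro: mult_right_mono split: if_splits)
  qed
  have len: "length (xi P_base) = 4" "length (eta P_base) = 4" by (simp_all add: P_base_def)
  show ?thesis
    unfolding admissible_def load len split_paired_All
  proof (intro conjI allI impI ballI)
    show "0 \<le> base_weight a b R" for R using a b by (simp add: base_weight_def)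
    show "cycle X Y * a + top X Y * b \<le> 1" for X Y
      using combine[OF cycle_le top_le, of X Y] a b by simp
    show "cycle (xi P_base ! k) Y * a + top (xi P_base ! k) Y * b \<le> max a b" if "k < 4" for k Y
      using combine[of "xi P_base ! k" Y 1] column[of "xi P_base ! k" Y] that len by simp
    show "cycle X (eta P_base ! l) * a + top X (eta P_base ! l) * b \<le> 2 * (if low l then a else b)"
      if "l < 4" for l X
      using row[OF that cycle_le top_le] .
    show "cycle (xi P_base ! k) (eta P_base ! l) * a + top (xi P_base ! k) (eta P_base ! l) * b
        \<le> (if low l then a else b)" if "k < 4" "l < 4" for k l
      using row[OF that(2), of "xi P_base ! k" 1] column[of "xi P_base ! k" "eta P_base ! l"] that len
      by simp
  qed
qed

section \<open>Iterated crossbars\<close>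

lemma low_mod: "4 dvd q \<Longrightarrow> low (k mod q) \<longleftrightarrow> low k"
  by (simp add: low_def mod_mod_cancel)

lemma sum_low: "(\<Sum>i<4 * n. if low i then x else y) = 2 * real n * (x + y)"
proof (induction n)
  case (Suc n)
  have "{..<4 * Suc n} = insert (4 * n + 3) (insert (4 * n + 2) (insert (4 * n + 1) (insert (4 * n) {..<4 * n})))"
    by auto
  moreover have "low (4 * n)" "low (4 * n + 1)" "\<not> low (4 * n + 2)" "\<not> low (4 * n + 3)"
    by (simp_all add: low_def mod_add_eq[symmetric] mod_Suc)
  ultimately show ?case
    using Suc by (simp add: algebra_simps)
qed simp

lemma sum_crossbar_weight_total:
  assumes "well_formed D"
  shows "(\<Sum>Q\<in>rects (crossbar D). crossbar_weight D h v Q) =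
    (\<Sum>i<length (xi D). \<Sum>R\<in>rects D. h i R) + (\<Sum>j<length (xi D). \<Sum>R\<in>rects D. v j R)"
  using sum_crossbar_weight[of D "\<lambda>_. 1"] assms by (simp add: well_formed_def)

definition level1_weight :: "real \<Rightarrow> real \<Rightarrow> real \<Rightarrow> real \<Rightarrow> rect \<Rightarrow> real" where
  "level1_weight a b c d = crossbar_weight P_base (\<lambda>_. base_weight a b) (\<lambda>_. base_weight c d)"

lemma length_base: "length (xi P_base) = 4"
  by (simp add: P_base_def)

lemma admissible_level1_weight:
  assumes "0 \<le> a" "a \<le> 1 / 2" "0 \<le> b" "b \<le> 1 / 2" "0 \<le> c" "c \<le> 1 / 2" "0 \<le> d" "d \<le> 1 / 2"
  shows "admissible (crossbar P_base) (level1_weight a b c d)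
    (\<lambda>k. max (max a b + (if low k then c else d)) (2 * (if low k then c else d)))
    (\<lambda>l. max (max c d + (if low l then a else b)) (2 * (if low l then a else b)))
    (\<lambda>k l. (if low k then c else d) + (if low l then a else b))"
  unfolding level1_weight_def
  by (rule admissible_crossbar[OF well_formed_base admissible_base admissible_base])
    (use assms in \<open>auto simp: length_base low_mod\<close>)

lemma sum_level1_weight:
  "(\<Sum>R\<in>rects (crossbar P_base). level1_weight a b c d R) = 4 * (5 * a + 3 * b) + 4 * (5 * c + 3 * d)"
  by (simp add: level1_weight_def sum_crossbar_weight_total well_formed_base sum_base_weight length_base)

text \<open>The columns put the load $\max(e + 1/4, 2e)$ on the low markers, which is 1 for $e = 1/2$, but only $1/4$ on
the high ones. So the low rows stay empty, and the high rows get the uniform weight $e$. In return, the loads on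
the vertical markers of the result are only $e + 1/4$ on low ones and $e$ on high ones.\<close>

definition level2_weight :: "real \<Rightarrow> rect \<Rightarrow> real" where
  "level2_weight e = crossbar_weight (crossbar P_base)
     (\<lambda>i. let e' = if low i then 0 else e in level1_weight e' e' 0 0) (\<lambda>_. level1_weight (1 / 4) 0 e 0)"

lemma length_crossbar_base: "length (xi (crossbar P_base)) = 16"
  by (simp add: length_xi_crossbar well_formed_base length_base)

text \<open>The load on new vertical markers is the same inside low and high rows: a low row adds nothing and meets weight
$e$ in the column, and a high row adds $e$ where the column has only its share on low horizontal markers. The
two bounds by 2 are crude, as only the vertical markers matter for the next step.\<close>

lemma admissible_level2_weight:
  assumes "1 / 4 \<le> e" "e \<le> 1 / 2"
  shows "admissible (crossbar (crossbar P_base)) (level2_weight e)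
    (\<lambda>k. e + (if low k then 1 / 4 else 0)) (\<lambda>_. 2) (\<lambda>_ _. 2)"
  unfolding level2_weight_def Let_def
  by (rule admissible_crossbar[OF well_formed_crossbar[OF well_formed_base]
        admissible_level1_weight admissible_level1_weight])
    (use assms in \<open>auto simp: length_crossbar_base low_mod\<close>)

lemma sum_level2_weight:
  "(\<Sum>R\<in>rects (crossbar (crossbar P_base)). level2_weight e R) = 80 + 576 * e"
proof -
  have "(\<Sum>i<16. \<Sum>R\<in>rects (crossbar P_base). (let e' = if low i then 0 else e in level1_weight e' e' 0 0) R) =
      (\<Sum>i<4 * 4. if low i then 0 else 32 * e)"
    by (intro sum.cong) (simp_all add: Let_def sum_level1_weight)
  also have "\<dots> = 256 * e" unfolding sum_low by simp
  finally show ?thesis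
    by (simp add: level2_weight_def sum_crossbar_weight_total well_formed_base well_formed_crossbar
        length_crossbar_base sum_level1_weight)
qed

lemma length_crossbar_crossbar_base: "length (xi (crossbar (crossbar P_base))) = 256"
  by (simp add: length_xi_crossbar well_formed_base well_formed_crossbar length_crossbar_base)

text \<open>Row $i$ and column $j$ cross at the vertical markers $j$ of the row and $i$ of the column. The load
there is at most $1/4 + 1/4 + 1/4 + 1/4$ if both indices are low, $1/4$ and $1/2 + 1/4$ if exactly one is low,
and $1/2 + 1/2$ if both are high: the capacity is used up at every crossing. The values $1/4$ and $1/2$ give
the unequal capacities that the low and high markers call for.\<close>

definition level3_weight :: "rect \<Rightarrow> real" where
  "level3_weight = crossbar_weight (crossbar (crossbar P_base))
     (\<lambda>i. level2_weight (if low i then 1 / 4 else 1 / 2)) (\<lambda>j. level2_weight (if low j then 1 / 4 else 1 / 2))"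

lemma admissible_level3_weight:
  "admissible (crossbar (crossbar (crossbar P_base))) level3_weight (\<lambda>_. 4) (\<lambda>_. 4) (\<lambda>_ _. 4)"
  unfolding level3_weight_def
  by (rule admissible_crossbar[OF well_formed_crossbar[OF well_formed_crossbar[OF well_formed_base]]
        admissible_level2_weight admissible_level2_weight]) auto

lemma sum_level3_weight:
  "(\<Sum>R\<in>rects (crossbar (crossbar (crossbar P_base))). level3_weight R) = 151552"
proof -
  have "(\<Sum>i<256. \<Sum>R\<in>rects (crossbar (crossbar P_base)). level2_weight (if low i then 1 / 4 else 1 / 2) R) =
      (\<Sum>i<4 * 64. if low i then 224 else 368)"
    by (intro sum.cong) (simp_all add: sum_level2_weight)
  also have "\<dots> = 75776" unfolding sum_low by simp
  finally show ?thesis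
    by (simp add: level3_weight_def sum_crossbar_weight_total well_formed_base well_formed_crossbar
        length_crossbar_crossbar_base)
qed

theorem theorem2:
  shows "alpha_star (rects (P_fam 3)) / real (nu (rects (P_fam 3))) \<ge> 73 / 32"
proof -
  let ?D = "crossbar (crossbar (crossbar P_base))"
  have P3: "P_fam 3 = ?D" by (simp add: numeral_eq_Suc)
  have wf: "well_formed ?D" by (intro well_formed_crossbar well_formed_base)
  have "marker_bounded ?D"
    by (intro marker_bounded_crossbar marker_bounded_base well_formed_crossbar well_formed_base)
  then have "nu (rects ?D) \<le> 65536"
    using marker_bounded_nu_le[OF wf]
    by (simp add: length_xi_crossbar well_formed_base well_formed_crossbar length_crossbar_crossbar_base)
  moreover have "rects ?D \<noteq> {}"
    using sum_level3_weight by force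
  then have "0 < nu (rects ?D)"
    using wf by (intro nu_pos) (auto simp: well_formed_def)
  moreover have "151552 \<le> alpha_star (rects ?D)"
    using alpha_star_ge[OF wf admissible_level3_weight] by (simp add: sum_level3_weight)
  ultimately show ?thesis
    unfolding P3 by (simp add: field_simps)
qed

end
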